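(* Let $n\ge 2$, let $V=(v_1,\dots,v_n)\in[0,1]^n$, and let $\Gamma=\Gamma_V$ be the $n\times n$ matrix with $\gamma_{ii}=1-v_i$ for each $i\in[n]$ and $\gamma_{ij}=v_i$ for all $j\ne i$. Then, for every $n$-player linear congestion game $\mathcal{G}$, the linear congestion game with altruistic social context $(\mathcal{G},\Gamma)$ admits an exact potential function.
   Context: Linear congestion game: a set of players $[n]=\{1,\dots,n\}$, $n\ge 2$, a finite set $E$ of resources, for each player $i$ a non-empty set $S_i\subseteq 2^E$ of strategies (each strategy is a non-empty subset of $E$), and for each $e\in E$ a latency function $\ell_e(x)=\alpha_e x+\beta_e$ with $\alpha_e,\beta_e\ge 0$. A strategy profile is $S=(s_1,\dots,s_n)$ with $s_i\in S_i$. The congestion of $e$ in $S$ is $n_e(S)=|\{j\in[n]:e\in s_j\}|$, and the cost of player $i$ in the underlying game is $c_i(S)=\sum_{e\in s_i}(\alpha_e n_e(S)+\beta_e)$. For $t\in S_i$, $S_{-i}\diamond t$ denotes the profile obtained from $S$ by replacing $s_i$ with $t$. A linear congestion game with altruistic social context is a pair $(\mathcal{G},\Gamma)$ where $\mathcal{G}$ is a linear congestion game with $n$ players and $\Gamma=(\gamma_{ij})\in\mathbb{R}^{n\times n}$ has non-negative entries; players and strategies are those of $\mathcal{G}$, but the cost of player $i$ in $S$ is $\widehat{c}_i(S)=\sum_{j\in[n]}\gamma_{ij}\,c_j(S)$. An exact potential function for $(\mathcal{G},\Gamma)$ is a real-valued function $\Phi$ on strategy profiles such that $\Phi(S)-\Phi(S_{-i}\diamond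 t)=\widehat{c}_i(S)-\widehat{c}_i(S_{-i}\diamond t)$ for every profile $S$, player $i$ and $t\in S_i$. *)

theory Defs
  imports Complex_Main "HOL-Library.FuncSet"
begin

text \<open>
  Players of an \<open>n\<close>-player game are the natural numbers in \<open>{1..n}\<close>; families indexed by players
  and matrices are functions on \<open>nat\<close>, of which only the values on \<open>{1..n}\<close> matter.
\<close>

record 'e congestion_game =
  resources :: "'e set"
  strategies :: "nat \<Rightarrow> 'e set set"
  slope :: "'e \<Rightarrow> real"
  offset :: "'e \<Rightarrow> real"

definition latency :: "'e congestion_game \<Rightarrow> 'e \<Rightarrow> real \<Rightarrow> real" where
  "latency G e x = slope G e * x + offset G e"

definition linear_congestion_game :: "nat \<Rightarrow> 'e congestion_game \<Rightarrow> bool" where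
  "linear_congestion_game n G \<longleftrightarrow>
     n \<ge> 2 \<and>
     finite (resources G) \<and>
     (\<forall>i\<in>{1..n}. strategies G i \<noteq> {} \<and> strategies G i \<subseteq> Pow (resources G) \<and> {} \<notin> strategies G i) \<and>
     (\<forall>e\<in>resources G. slope G e \<ge> 0 \<and> offset G e \<ge> 0)"

text \<open>
  Profiles are extensional functions, so they correspond exactly to tuples; replacing the strategy
  of player \<open>i\<close> in \<open>s\<close> by \<open>t\<close> is the function update \<open>s(i := t)\<close>.
\<close>

definition profiles :: "nat \<Rightarrow> 'e congestion_game \<Rightarrow> (nat \<Rightarrow> 'e set) set" where
  "profiles n G = (\<Pi>\<^sub>E i\<in>{1..n}. strategies G i)"

definition congestion :: "nat \<Rightarrow> (nat \<Rightarrow> 'e set) \<Rightarrow> 'e \<Rightarrow> nat" where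
  "congestion n s e = card {j \<in> {1..n}. e \<in> s j}"

definition cost :: "nat \<Rightarrow> 'e congestion_game \<Rightarrow> nat \<Rightarrow> (nat \<Rightarrow> 'e set) \<Rightarrow> real" where
  "cost n G i s = (\<Sum>e\<in>s i. latency G e (real (congestion n s e)))"

definition altruistic_game ::
    "nat \<Rightarrow> 'e congestion_game \<Rightarrow> (nat \<Rightarrow> nat \<Rightarrow> real) \<Rightarrow> bool" where
  "altruistic_game n G \<Gamma> \<longleftrightarrow>
     linear_congestion_game n G \<and> (\<forall>i\<in>{1..n}. \<forall>j\<in>{1..n}. \<Gamma> i j \<ge> 0)"

definition altruistic_cost ::
    "nat \<Rightarrow> 'e congestion_game \<Rightarrow> (nat \<Rightarrow> nat \<Rightarrow> real) \<Rightarrow> nat \<Rightarrow> (nat \<Rightarrow> 'e set) \<Rightarrow> real" where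
  "altruistic_cost n G \<Gamma> i s = (\<Sum>j\<in>{1..n}. \<Gamma> i j * cost n G j s)"

definition exact_potential ::
    "nat \<Rightarrow> 'e congestion_game \<Rightarrow> (nat \<Rightarrow> nat \<Rightarrow> real) \<Rightarrow> ((nat \<Rightarrow> 'e set) \<Rightarrow> real) \<Rightarrow> bool" where
  "exact_potential n G \<Gamma> \<Phi> \<longleftrightarrow>
     (\<forall>s\<in>profiles n G. \<forall>i\<in>{1..n}. \<forall>t\<in>strategies G i.
        \<Phi> s - \<Phi> (s(i := t)) = altruistic_cost n G \<Gamma> i s - altruistic_cost n G \<Gamma> i (s(i := t)))"

definition altruism_matrix :: "(nat \<Rightarrow> real) \<Rightarrow> nat \<Rightarrow> nat \<Rightarrow> real" where
  "altruism_matrix v i j = (if j = i then 1 - v i else v i)"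

lemma altruistic_game_altruism_matrix:
  assumes "linear_congestion_game n G" and "\<And>i. i \<in> {1..n} \<Longrightarrow> v i \<in> {0..1}"
  shows "altruistic_game n G (altruism_matrix v)"
  using assms by (auto simp: altruistic_game_def altruism_matrix_def)

end

theory Submission
  imports Defs
begin

text \<open>
  The altruistic cost is \<open>(1 - 2 v\<^sub>i) c\<^sub>i + v\<^sub>i C\<close>, where \<open>C\<close> is the sum of all costs, and it splits into
  contributions of single resources. If \<open>R\<close> players other than \<open>i\<close> use a resource with latency
  \<open>\<alpha> x + \<beta>\<close>, joining it changes the altruistic cost of \<open>i\<close> by
  \<open>(1 - 2 v\<^sub>i) (\<alpha> (R + 1) + \<beta>) + v\<^sub>i (\<alpha> (2 R + 1) + \<beta>) = \<alpha> R + (\<alpha> + \<beta>) (1 - v\<^sub>i)\<close>.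
  As \<open>R\<close> no longer carries the factor \<open>v\<^sub>i\<close>, the potential can charge \<open>\<alpha>\<close> for every pair of users of
  the resource and \<open>(\<alpha> + \<beta>) (1 - v\<^sub>i)\<close> for every user \<open>i\<close>.
\<close>

definition altruism_potential ::
    "nat \<Rightarrow> 'e congestion_game \<Rightarrow> (nat \<Rightarrow> real) \<Rightarrow> (nat \<Rightarrow> 'e set) \<Rightarrow> real" where
  "altruism_potential n G v s = (\<Sum>e\<in>resources G.
     slope G e * (real (congestion n s e) * (real (congestion n s e) - 1) / 2) +
     (slope G e + offset G e) * (\<Sum>i\<in>{1..n}. (1 - v i) * of_bool (e \<in> s i)))"

lemma congestion_eq_sum: "real (congestion n s e) = (\<Sum>j\<in>{1..n}. of_bool (e \<in> s j))"
  by (simp add: congestion_def sum_of_bool_eq Int_def)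

text \<open>The indicator makes the index set the same for all players and profiles, so that costs
  can be added up and compared resource by resource.\<close>

lemma cost_eq_sum_resources:
  assumes "finite (resources G)" and "s i \<subseteq> resources G"
  shows "cost n G i s =
    (\<Sum>e\<in>resources G. of_bool (e \<in> s i) * latency G e (real (congestion n s e)))"
  unfolding cost_def using assms by (intro sum.mono_neutral_cong_left) auto

text \<open>Row \<open>i\<close> of the matrix is constantly \<open>v i\<close> except on the
  diagonal, where \<open>1 - v i = (1 - 2 * v i) + v i\<close>.\<close>

lemma altruistic_cost_altruism_matrix:
  assumes "i \<in> {1..n}"
  shows "altruistic_cost n G (altruism_matrix v) i s =
    (1 - 2 * v i) * cost n G i s + v i * (\<Sum>j\<in>{1..n}. cost n G j s)"
proof -
  have "(\<Sum>j\<in>{1..n} - {i}. altruism_matrix v i j * cost n G j s) =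
      v i * (\<Sum>j\<in>{1..n} - {i}. cost n G j s)"
    unfolding sum_distrib_left by (intro sum.cong) (auto simp: altruism_matrix_def)
  then show ?thesis
    unfolding altruistic_cost_def
    using assms by (simp add: sum.remove altruism_matrix_def algebra_simps)
qed

lemma altruistic_cost_eq_sum_resources:
  assumes "finite (resources G)" and "\<And>j. j \<in> {1..n} \<Longrightarrow> s j \<subseteq> resources G" and "i \<in> {1..n}"
  shows "altruistic_cost n G (altruism_matrix v) i s = (\<Sum>e\<in>resources G.
    ((1 - 2 * v i) * of_bool (e \<in> s i) + v i * real (congestion n s e)) *
    latency G e (real (congestion n s e)))"
proof -
  have "(\<Sum>j\<in>{1..n}. cost n G j s) = (\<Sum>j\<in>{1..n}. \<Sum>e\<in>resources G.
      of_bool (e \<in> s j) * latency G e (real (congestion n s e)))"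
    using assms by (intro sum.cong cost_eq_sum_resources) auto
  \<comment> \<open>Exchanging the two sums counts, for each resource, its users; all of them pay
    the same latency there.\<close>
  also have "\<dots> = (\<Sum>e\<in>resources G.
      real (congestion n s e) * latency G e (real (congestion n s e)))"
    by (subst sum.swap) (simp only: sum_distrib_right [symmetric] congestion_eq_sum [symmetric])
  finally have total: "(\<Sum>j\<in>{1..n}. cost n G j s) = \<dots>" .
  have "cost n G i s =
      (\<Sum>e\<in>resources G. of_bool (e \<in> s i) * latency G e (real (congestion n s e)))"
    using assms by (intro cost_eq_sum_resources) auto
  then show ?thesis
    unfolding altruistic_cost_altruism_matrix [OF assms(3)] total
    by (simp only: sum_distrib_left sum.distrib [symmetric] distrib_right mult.assoc)
qed

text \<open>The remainder is written with \<open>s\<close> instead of the updated profile, so it is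
  literally the one obtained by splitting off player \<open>i\<close> from the sum for
  \<open>s\<close>.\<close>

lemma sum_update:
  assumes "finite A" and "i \<in> A"
  shows "(\<Sum>j\<in>A. f j ((s(i := t)) j)) = f i t + (\<Sum>j\<in>A - {i}. f j (s j))"
proof -
  have "(\<Sum>j\<in>A - {i}. f j ((s(i := t)) j)) = (\<Sum>j\<in>A - {i}. f j (s j))"
    by (intro sum.cong) auto
  then show ?thesis using assms by (simp add: sum.remove)
qed

text \<open>The potential and the altruistic cost of \<open>i\<close> are both sums over resources,
  and their changes already agree on each single resource.\<close>

lemma exact_potential_altruism_potential:
  assumes "linear_congestion_game n G"
  shows "exact_potential n G (altruism_matrix v) (altruism_potential n G v)"
  unfolding exact_potential_def
proof (intro ballI)
  fix s i t
  assume s: "s \<in> profiles n G" and i: "i \<in> {1..n}" and t: "t \<in> strategies G i"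
  let ?s' = "s(i := t)"
  have fin: "finite (resources G)"
    and strat: "\<And>j u. j \<in> {1..n} \<Longrightarrow> u \<in> strategies G j \<Longrightarrow> u \<subseteq> resources G"
    using assms unfolding linear_congestion_game_def by blast+
  have sub: "s j \<subseteq> resources G" if "j \<in> {1..n}" for j
    using s strat that unfolding profiles_def by (metis PiE_mem)
  have sub': "?s' j \<subseteq> resources G" if "j \<in> {1..n}" for j
    using sub strat t that by simp
  have "altruism_potential n G v s - altruism_potential n G v ?s' =
      (\<Sum>e\<in>resources G.
        ((1 - 2 * v i) * of_bool (e \<in> s i) + v i * real (congestion n s e)) *
          latency G e (real (congestion n s e)) -
        ((1 - 2 * v i) * of_bool (e \<in> ?s' i) + v i * real (congestion n ?s' e)) *
          latency G e (real (congestion n ?s' e)))"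
    unfolding altruism_potential_def sum_subtractf [symmetric]
  proof (intro sum.cong refl)
    fix e
    \<comment> \<open>The share of the other players in the congestion and in the weighted count of
      users; the deviation of \<open>i\<close> leaves both unchanged.\<close>
    define R where "R = (\<Sum>j\<in>{1..n} - {i}. of_bool (e \<in> s j) :: real)"
    define W where "W = (\<Sum>j\<in>{1..n} - {i}. (1 - v j) * of_bool (e \<in> s j))"
    have N: "real (congestion n s e) = of_bool (e \<in> s i) + R"
      unfolding congestion_eq_sum R_def using i by (intro sum.remove) auto
    have N': "real (congestion n ?s' e) = of_bool (e \<in> t) + R"
      unfolding congestion_eq_sum R_def
      using i by (intro sum_update [where f = "\<lambda>j u. of_bool (e \<in> u)"]) auto
    have W: "(\<Sum>j\<in>{1..n}. (1 - v j) * of_bool (e \<in> s j)) = (1 - v i) * of_bool (e \<in> s i) + W"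
      unfolding W_def using i by (intro sum.remove) auto
    have W': "(\<Sum>j\<in>{1..n}. (1 - v j) * of_bool (e \<in> ?s' j)) = (1 - v i) * of_bool (e \<in> t) + W"
      unfolding W_def
      using i by (intro sum_update [where f = "\<lambda>j u. (1 - v j) * of_bool (e \<in> u)"]) auto
    show "slope G e * (real (congestion n s e) * (real (congestion n s e) - 1) / 2) +
          (slope G e + offset G e) * (\<Sum>j\<in>{1..n}. (1 - v j) * of_bool (e \<in> s j)) -
        (slope G e * (real (congestion n ?s' e) * (real (congestion n ?s' e) - 1) / 2) +
          (slope G e + offset G e) * (\<Sum>j\<in>{1..n}. (1 - v j) * of_bool (e \<in> ?s' j))) =
        ((1 - 2 * v i) * of_bool (e \<in> s i) + v i * real (congestion n s e)) *
          latency G e (real (congestion n s e)) -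
        ((1 - 2 * v i) * of_bool (e \<in> ?s' i) + v i * real (congestion n ?s' e)) *
          latency G e (real (congestion n ?s' e))"
      unfolding N N' W W' latency_def
      \<comment> \<open>If \<open>i\<close> uses \<open>e\<close> in both profiles or in neither,
        both sides vanish; otherwise they are plus or minus the marginal cost of joining
        \<open>e\<close>.\<close>
      by (cases "e \<in> s i"; cases "e \<in> t") (simp_all add: field_simps)
  qed
  also have "\<dots> = altruistic_cost n G (altruism_matrix v) i s -
      altruistic_cost n G (altruism_matrix v) i ?s'"
    using altruistic_cost_eq_sum_resources [where s = s, OF fin _ i]
      altruistic_cost_eq_sum_resources [where s = ?s', OF fin _ i] sub sub'
    by (simp only: sum_subtractf)
  finally show "altruism_potential n G v s - altruism_potential n G v ?s' =
      altruistic_cost n G (altruism_matrix v) i s -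
      altruistic_cost n G (altruism_matrix v) i ?s'" .
qed

theorem theorem8:
  fixes n :: nat and v :: "nat \<Rightarrow> real" and G :: "'e congestion_game"
  assumes "n \<ge> 2"
    and "\<And>i. i \<in> {1..n} \<Longrightarrow> v i \<in> {0..1}"
    and "linear_congestion_game n G"
  shows "\<exists>\<Phi>. exact_potential n G (altruism_matrix v) \<Phi>"
  using exact_potential_altruism_potential [OF assms(3)] by blast

end
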